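(* Let $H$ be a complex separable Hilbert space and let $L\colon \operatorname{Dom}(L)\subset H\to H$ be a (densely defined) self-adjoint linear operator such that (a) $0\in\sigma(L)$; (b) $(-\delta,0)\subset\rho(L)$ for some $\delta>0$, where $\rho(L)$ is the resolvent set; (c) $\inf\sigma(L)=-\gamma$ for some (finite) $\gamma\geqslant 0$. Let $h\in H$. Let $N\colon H\to H$ be bounded, demicontinuous, with $N(0)=0$, and assume that (i) there exists $\alpha>\gamma/\delta^2$ such that for all $u,u'\in H$ $$\langle N(u)-N(u'),u-u'\rangle_r\geqslant\alpha\|N(u)-N(u')\|^2;$$ (ii) $\displaystyle\limsup_{k\to\infty}\frac{\langle N(u_k),u_k\rangle_r}{\|u_k\|}>\frac{\gamma\|h\|}{\delta^2\alpha-\gamma}$ for each sequence $\{u_k\}_{k\in\mathbb{N}}\subset H$ such that $\|u_k\|\to+\infty$; (iii) $\displaystyle J_N(u)>\frac{\gamma\|h\|}{\delta^2\alpha-\gamma}+\langle h,u\rangle_r$ for all $u\in\operatorname{Ker}L$ with $\|u\|=1$. Then the equation $Lu+N(u)=h$ has a solution $u\in\operatorname{Dom}(L)$.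
   Context: Here $\langle u,v\rangle_r=\operatorname{Re}\langle u,v\rangle$. The symbol $\rightharpoonup$ denotes weak convergence and $\to$ norm convergence in $H$. A map $N\colon H\to H$ (in general nonlinear) is bounded if it maps bounded sets to bounded sets, and demicontinuous if $u_k\to u_0$ implies $N(u_k)\rightharpoonup N(u_0)$. The recession functional $J_N\colon H\to[-\infty,+\infty]$ is $$J_N(u)=\inf\Big\{\liminf_{k\to\infty}\langle N(t_kv_k),v_k\rangle_r:\ t_k\to+\infty,\ \{v_k\}_{k\in\mathbb{N}}\subset H,\ v_k\rightharpoonup u\Big\}.$$ *)

theory Defs
  imports "HOL-Analysis.Analysis"
begin

text \<open>
  The distribution only provides real inner product spaces. A complex inner product space is
  taken to be a real one whose scalar multiplication and inner product come from complex ones: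
  the library's \<^const>\<open>inner\<close> is the real part of \<open>cinner\<close>, so that norm and topology are those
  induced by \<open>cinner\<close>. The complex inner product is linear in the first argument.
\<close>

class complex_inner = real_inner +
  fixes scaleC :: "complex \<Rightarrow> 'a \<Rightarrow> 'a" (infixr "*\<^sub>C" 75)
    and cinner :: "'a \<Rightarrow> 'a \<Rightarrow> complex"
  assumes scaleC_add_right: "a *\<^sub>C (x + y) = a *\<^sub>C x + a *\<^sub>C y"
    and scaleC_add_left: "(a + b) *\<^sub>C x = a *\<^sub>C x + b *\<^sub>C x"
    and scaleC_scaleC: "a *\<^sub>C (b *\<^sub>C x) = (a * b) *\<^sub>C x"
    and scaleR_scaleC: "r *\<^sub>R x = complex_of_real r *\<^sub>C x"
    and cinner_commute: "cinner x y = cnj (cinner y x)"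
    and cinner_add_left: "cinner (x + y) z = cinner x z + cinner y z"
    and cinner_scaleC_left: "cinner (a *\<^sub>C x) y = a * cinner x y"
    and inner_eq_Re_cinner: "inner x y = Re (cinner x y)"

class complex_hilbert = complex_inner + complete_space

instantiation complex :: complex_hilbert
begin

definition "scaleC (a :: complex) (x :: complex) = a * x"
definition "cinner (x :: complex) (y :: complex) = x * cnj y"

instance
  by standard
    (simp_all add: scaleC_complex_def cinner_complex_def inner_complex_def
      scaleR_conv_of_real algebra_simps)

end

global_interpretation complex_vector: vector_space "scaleC :: complex \<Rightarrow> 'a \<Rightarrow> 'a::complex_inner"
proof
  show "1 *\<^sub>C x = x" for x :: 'a
    using scaleR_scaleC[of 1 x] by simp
qed (simp_all add: scaleC_add_right scaleC_add_left scaleC_scaleC)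

text \<open>
  An operator is a pair of its domain \<open>D\<close> and a total function \<open>L\<close>; the values of \<open>L\<close> outside
  \<open>D\<close> are irrelevant.
\<close>

definition linear_operator :: "'a::complex_inner set \<Rightarrow> ('a \<Rightarrow> 'a) \<Rightarrow> bool" where
  "linear_operator D L \<longleftrightarrow> complex_vector.subspace D \<and>
     (\<forall>u\<in>D. \<forall>v\<in>D. L (u + v) = L u + L v) \<and> (\<forall>c. \<forall>u\<in>D. L (c *\<^sub>C u) = c *\<^sub>C L u)"

definition op_kernel :: "'a::complex_inner set \<Rightarrow> ('a \<Rightarrow> 'a) \<Rightarrow> 'a set" where
  "op_kernel D L = {u \<in> D. L u = 0}"

definition adjoint_dom :: "'a::complex_inner set \<Rightarrow> ('a \<Rightarrow> 'a) \<Rightarrow> 'a set" where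
  "adjoint_dom D L = {v. \<exists>w. \<forall>u\<in>D. cinner (L u) v = cinner u w}"

text \<open>The vector chosen here is unique on \<open>adjoint_dom D L\<close> whenever \<open>D\<close> is dense.\<close>

definition adjoint_op :: "'a::complex_inner set \<Rightarrow> ('a \<Rightarrow> 'a) \<Rightarrow> 'a \<Rightarrow> 'a" where
  "adjoint_op D L v = (THE w. \<forall>u\<in>D. cinner (L u) v = cinner u w)"

definition self_adjoint :: "'a::complex_inner set \<Rightarrow> ('a \<Rightarrow> 'a) \<Rightarrow> bool" where
  "self_adjoint D L \<longleftrightarrow> linear_operator D L \<and> closure D = UNIV \<and>
     adjoint_dom D L = D \<and> (\<forall>v\<in>D. adjoint_op D L v = L v)"

text \<open>
  Real linearity of the inverse, as contained in \<^const>\<open>bounded_linear\<close>, is no restriction: the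
  inverse of a complex linear bijection is complex linear.
\<close>

definition resolvent_set :: "'a::complex_inner set \<Rightarrow> ('a \<Rightarrow> 'a) \<Rightarrow> complex set" where
  "resolvent_set D L = {z. bij_betw (\<lambda>u. L u - z *\<^sub>C u) D UNIV \<and>
     bounded_linear (inv_into D (\<lambda>u. L u - z *\<^sub>C u))}"

definition spectrum :: "'a::complex_inner set \<Rightarrow> ('a \<Rightarrow> 'a) \<Rightarrow> complex set" where
  "spectrum D L = - resolvent_set D L"

definition weakly_tendsto :: "(nat \<Rightarrow> 'a::complex_inner) \<Rightarrow> 'a \<Rightarrow> bool" where
  "weakly_tendsto v u \<longleftrightarrow> (\<forall>w. (\<lambda>k. cinner (v k) w) \<longlonglongrightarrow> cinner u w)"

definition bounded_map :: "('a::complex_inner \<Rightarrow> 'a) \<Rightarrow> bool" where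
  "bounded_map N \<longleftrightarrow> (\<forall>B. bounded B \<longrightarrow> bounded (N ` B))"

definition demicontinuous :: "('a::complex_inner \<Rightarrow> 'a) \<Rightarrow> bool" where
  "demicontinuous N \<longleftrightarrow> (\<forall>u u\<^sub>0. u \<longlonglongrightarrow> u\<^sub>0 \<longrightarrow> weakly_tendsto (\<lambda>k. N (u k)) (N u\<^sub>0))"

definition recession :: "('a::complex_inner \<Rightarrow> 'a) \<Rightarrow> 'a \<Rightarrow> ereal" where
  "recession N u = Inf {liminf (\<lambda>k. ereal (Re (cinner (N (t k *\<^sub>R v k)) (v k)))) | t v.
     filterlim t at_top sequentially \<and> weakly_tendsto v u}"

end

theory Submission
  imports Defs "HOL-Complex_Analysis.Great_Picard"
begin

text \<open>
  Write \<open>\<beta> = \<gamma> / \<delta>\<^sup>2 < \<alpha>\<close> and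
  \<open>s = 1 / (2 * \<alpha>)\<close>. The spectrum of \<open>L\<close> avoids
  \<open>(-\<delta>, 0)\<close>, so that each spectral value \<open>\<lambda>\<close> satisfies
  \<open>\<lambda> \<ge> - \<beta> * \<lambda>\<^sup>2\<close>; correspondingly
  \<open>\<langle>L u, u\<rangle> \<ge> - \<beta> * \<parallel>L u\<parallel>\<^sup>2\<close> on the
  domain (\<open>spectral_gap_consequences\<close>). The reason is that a self-adjoint operator
  whose resolvent set contains \<open>(c - r, c + r)\<close> satisfies
  \<open>\<parallel>L u - c u\<parallel> \<ge> r * \<parallel>u\<parallel>\<close>
  (\<open>spectral_gap_lower_bound\<close>), and squaring this inequality with
  \<open>c = - r\<close> gives a lower bound for the quadratic form.

  Completing squares, the bound on the form shows that \<open>(L + s)\<^sup>-\<^sup>1\<close> has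
  norm at most \<open>1 / s\<close>, and cocoercivity of \<open>N\<close> shows that
  \<open>s - N\<close> is Lipschitz with constant \<open>s\<close>. Since
  \<open>L u + N u = h\<close> is the same as \<open>(L + s) u = s u - N u + h\<close>, solutions
  are the fixed points of the nonexpansive map
  \<open>T u = (L + s)\<^sup>-\<^sup>1 (s u - N u + h)\<close>. Such a map need not have a fixed
  point, but the regularized equations \<open>T u = (1 + \<tau>) u\<close> with
  \<open>\<tau> > 0\<close> are solvable by contraction. Monotonicity of \<open>1 - T\<close> shows
  that their solutions either converge in norm to a fixed point as \<open>\<tau>\<close> tends to
  \<open>0\<close>, or have norms tending to infinity
  (\<open>nonexpansive_fixpoint_or_blowup\<close>).

  The growth condition on \<open>N\<close> and the condition on its recession functional exclude the
  second alternative (\<open>bounded_along_regularization\<close>). If the solutions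
  \<open>u n\<close> blow up, put \<open>v n = u n / \<parallel>u n\<parallel>\<close>. Testing the
  regularized equation with \<open>u n\<close> gives, up to terms that vanish in the limit,
  \<open>(1 - \<beta> / \<alpha>) * \<langle>N (u n), v n\<rangle> \<le> \<langle>h, v n\<rangle>\<close>
  (\<open>energy_estimate\<close>); it also gives
  \<open>L (v n) \<longlonglongrightarrow> 0\<close>. Let \<open>v0\<close> be a weak limit of a
  subsequence of the \<open>v n\<close>. It lies in the kernel of \<open>L\<close>, because the
  graph of \<open>L\<close> is weakly closed. It is nonzero, because the growth condition forces
  \<open>\<langle>h, v0\<rangle> > 0\<close>. The recession functional is positively homogeneous, so
  that the condition on it, although stated for unit vectors, applies to \<open>v0\<close>, whose
  norm may be less than \<open>1\<close>. As
  \<open>1 / (1 - \<beta> / \<alpha>) = 1 + \<beta> / (\<alpha> - \<beta>)\<close>, the energy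
  estimate bounds the recession functional at \<open>v0 / \<parallel>v0\<parallel>\<close> by
  \<open>\<langle>h, v0\<rangle> / \<parallel>v0\<parallel> + \<beta> * \<parallel>h\<parallel> / (\<alpha> - \<beta>)\<close>.
  This contradicts the recession condition.
\<close>

section \<open>Riesz representation and weak sequential compactness\<close>

lemma linear_term_zero_if_dominated:
  fixes a b :: real
  assumes "\<And>t. 0 \<le> t\<^sup>2 * a + 2 * t * b" and "a \<ge> 0"
  shows "b = 0"
proof -
  define t where "t = - b / (a + 1)"
  have "(a + 1) * t = - b"
    using assms(2) by (simp add: t_def)
  then have "(t\<^sup>2 * a + 2 * t * b) * (a + 1)\<^sup>2 = - (b\<^sup>2 * (a + 2))"
    by algebra
  moreover have "0 \<le> (t\<^sup>2 * a + 2 * t * b) * (a + 1)\<^sup>2"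
    using assms(1) by simp
  ultimately have "b\<^sup>2 * (a + 2) \<le> 0"
    by linarith
  then show ?thesis
    using assms(2) by (simp add: mult_le_0_iff)
qed

text \<open>
  The representing vector minimizes \<open>\<parallel>w\<parallel>\<^sup>2 - 2 * f w\<close>: by the
  parallelogram law minimizing sequences are Cauchy, and the first variation at the minimum is
  \<open>\<langle>w, x\<rangle> - f x\<close>.
\<close>

lemma Riesz_representation:
  fixes f :: "'a::{real_inner,complete_space} \<Rightarrow> real"
  assumes "bounded_linear f"
  obtains w where "\<And>x. f x = inner w x"
proof -
  interpret f: bounded_linear f by fact
  obtain K where K: "\<And>x. norm (f x) \<le> norm x * K"
    using f.bounded by blast
  define J where "J w = (norm w)\<^sup>2 - 2 * f w" for w
  have J_lower: "- K\<^sup>2 \<le> J w" for w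
  proof -
    have "f w \<le> norm w * K"
      using K[of w] by simp
    moreover have "0 \<le> (norm w - K)\<^sup>2"
      by simp
    ultimately show ?thesis
      unfolding J_def power2_diff by (simp add: mult.assoc)
  qed
  define m where "m = Inf (range J)"
  have bdd: "bdd_below (range J)"
    using J_lower by (intro bdd_belowI2)
  have m_le: "m \<le> J w" for w
    unfolding m_def by (rule cInf_lower[OF _ bdd]) simp
  have "\<exists>w. J w < m + 1 / real (Suc n)" for n
  proof -
    have "Inf (range J) < m + 1 / real (Suc n)"
      by (simp add: m_def)
    then show ?thesis
      using cInf_less_iff[OF _ bdd] by blast
  qed
  then obtain w where w: "\<And>n. J (w n) < m + 1 / real (Suc n)"
    by metis
  have parallelogram: "(norm (x - y))\<^sup>2 = 2 * J x + 2 * J y - 4 * J ((1/2) *\<^sub>R (x + y))" for x y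
    unfolding J_def power2_norm_eq_inner
    by (simp add: f.add f.scaleR inner_simps inner_commute field_simps)
  have dist_w: "(norm (w i - w j))\<^sup>2 \<le> 2 / real (Suc i) + 2 / real (Suc j)" for i j
    using parallelogram[of "w i" "w j"] w[of i] w[of j] m_le[of "(1/2) *\<^sub>R (w i + w j)"]
    by (smt (verit) add_divide_distrib)
  have "Cauchy w"
  proof (rule metric_CauchyI)
    fix e :: real assume "e > 0"
    then obtain n0 where n0: "4 / e\<^sup>2 < real n0"
      using reals_Archimedean2 by blast
    show "\<exists>M. \<forall>i\<ge>M. \<forall>j\<ge>M. dist (w i) (w j) < e"
    proof (intro exI[of _ n0] allI impI)
      fix i j assume ij: "i \<ge> n0" "j \<ge> n0"
      have small: "2 / real (Suc k) < e\<^sup>2 / 2" if "k \<ge> n0" for k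
      proof -
        have "4 / e\<^sup>2 < real (Suc k)"
          using n0 that by linarith
        then show ?thesis
          using \<open>e > 0\<close> by (simp add: field_simps)
      qed
      have "(norm (w i - w j))\<^sup>2 < e\<^sup>2"
        using dist_w[of i j] small[OF ij(1)] small[OF ij(2)] by linarith
      then show "dist (w i) (w j) < e"
        using \<open>e > 0\<close> by (simp add: dist_norm power_less_imp_less_base)
    qed
  qed
  then obtain z where z: "w \<longlonglongrightarrow> z"
    using Cauchy_convergent_iff convergent_def by blast
  have "(\<lambda>n. J (w n)) \<longlonglongrightarrow> J z"
    unfolding J_def by (intro tendsto_intros f.tendsto z)
  moreover have "(\<lambda>n. m + 1 / real (Suc n)) \<longlonglongrightarrow> m"
    using tendsto_add[OF tendsto_const LIMSEQ_inverse_real_of_nat, of m]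
    by (simp add: inverse_eq_divide)
  ultimately have "J z \<le> m"
    by (rule LIMSEQ_le) (use w less_imp_le in blast)
  then have min: "J z \<le> J x" for x
    using m_le order_trans by blast
  have "f x = inner z x" for x
  proof -
    have "0 \<le> t\<^sup>2 * (norm x)\<^sup>2 + 2 * t * (inner z x - f x)" for t
      using min[of "z + t *\<^sub>R x"]
      unfolding J_def power2_norm_eq_inner
      by (simp add: f.add f.scaleR inner_simps inner_commute algebra_simps power2_eq_square)
    then have "inner z x - f x = 0"
      by (rule linear_term_zero_if_dominated) simp
    then show ?thesis by simp
  qed
  then show ?thesis by (rule that)
qed

text \<open>
  A diagonal argument gives convergence of the inner products with a countable dense set.
  Boundedness of the sequence extends it to all vectors, and the limit is a bounded linear
  functional, which a vector represents.
\<close>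

lemma bounded_seq_weakly_convergent_subseq:
  fixes v :: "nat \<Rightarrow> 'a::{real_inner,complete_space}"
  assumes "separable_space (euclidean :: 'a topology)" and bound: "\<And>n. norm (v n) \<le> B"
  obtains r u where "strict_mono (r :: nat \<Rightarrow> nat)"
    and "\<And>w. (\<lambda>n. inner (v (r n)) w) \<longlonglongrightarrow> inner u w"
proof -
  have "B \<ge> 0"
    using bound[of 0] norm_ge_zero order_trans by blast
  obtain C :: "'a set" where C: "countable C" "closure C = UNIV"
    using assms(1) unfolding separable_space_def by auto
  \<comment> \<open>Normalizing the dense vectors makes the bound uniform in them, as the extraction of a
    convergent subsequence requires.\<close>
  have "norm (inner (v n) (sgn x)) \<le> B" for n x
  proof -
    have "norm (inner (v n) (sgn x)) \<le> norm (v n) * norm (sgn x)"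
      using Cauchy_Schwarz_ineq2 by simp
    also have "\<dots> \<le> B * 1"
      using bound \<open>B \<ge> 0\<close> by (intro mult_mono) (auto simp: norm_sgn)
    finally show ?thesis by simp
  qed
  then obtain r :: "nat \<Rightarrow> nat" where r: "strict_mono r"
    and r_lim: "\<And>x. x \<in> C \<Longrightarrow> \<exists>l. (\<lambda>n. inner (v (r n)) (sgn x)) \<longlonglongrightarrow> l"
    using function_convergent_subsequence[OF C(1), of "\<lambda>n x. inner (v n) (sgn x)" B] by metis
  have conv_C: "convergent (\<lambda>n. inner (v (r n)) x)" if x: "x \<in> C" for x
  proof -
    obtain l where "(\<lambda>n. inner (v (r n)) (sgn x)) \<longlonglongrightarrow> l"
      using r_lim[OF x] by blast
    then have "(\<lambda>n. norm x * inner (v (r n)) (sgn x)) \<longlonglongrightarrow> norm x * l"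
      by (intro tendsto_intros)
    moreover have "norm x * inner (v (r n)) (sgn x) = inner (v (r n)) x" for n
      by (cases "x = 0") (simp_all add: sgn_div_norm)
    ultimately show ?thesis
      by (auto simp: convergent_def)
  qed
  have "Cauchy (\<lambda>n. inner (v (r n)) x)" for x
  proof (rule metric_CauchyI)
    fix e :: real assume "e > 0"
    define d where "d = e / (3 * (B + 1))"
    have "d > 0" and dB: "B * d < e / 3"
      using \<open>e > 0\<close> \<open>B \<ge> 0\<close> by (auto simp: d_def field_simps)
    obtain y where y: "y \<in> C" "dist y x < d"
      using C(2) \<open>d > 0\<close> closure_approachable by blast
    have close: "\<bar>inner (v n) x - inner (v n) y\<bar> < e / 3" for n
    proof -
      have "\<bar>inner (v n) (x - y)\<bar> \<le> norm (v n) * norm (x - y)"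
        by (rule Cauchy_Schwarz_ineq2)
      also have "\<dots> \<le> B * d"
        using bound y(2) \<open>B \<ge> 0\<close>
        by (intro mult_mono) (auto simp: dist_norm norm_minus_commute)
      finally show ?thesis
        using dB by (simp add: inner_diff_right)
    qed
    have "Cauchy (\<lambda>n. inner (v (r n)) y)"
      using conv_C[OF y(1)] by (rule convergent_Cauchy)
    then obtain n0 where n0:
      "\<And>i j. i \<ge> n0 \<Longrightarrow> j \<ge> n0 \<Longrightarrow> dist (inner (v (r i)) y) (inner (v (r j)) y) < e / 3"
      using \<open>e > 0\<close> metric_CauchyD[of _ "e / 3"] by force
    show "\<exists>M. \<forall>i\<ge>M. \<forall>j\<ge>M. dist (inner (v (r i)) x) (inner (v (r j)) x) < e"
    proof (intro exI[of _ n0] allI impI)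
      fix i j assume "i \<ge> n0" "j \<ge> n0"
      then show "dist (inner (v (r i)) x) (inner (v (r j)) x) < e"
        using n0[of i j] close[of "r i"] close[of "r j"] unfolding dist_real_def by linarith
    qed
  qed
  then have conv: "convergent (\<lambda>n. inner (v (r n)) x)" for x
    by (rule Cauchy_convergent)
  define f where "f x = lim (\<lambda>n. inner (v (r n)) x)" for x
  have f: "(\<lambda>n. inner (v (r n)) x) \<longlonglongrightarrow> f x" for x
    using conv convergent_LIMSEQ_iff f_def by metis
  have "bounded_linear f"
  proof (rule bounded_linear_intro[of _ B])
    fix x y
    have "(\<lambda>n. inner (v (r n)) (x + y)) \<longlonglongrightarrow> f x + f y"
      using tendsto_add[OF f[of x] f[of y]] by (simp add: inner_add_right)
    then show "f (x + y) = f x + f y"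
      using LIMSEQ_unique[OF f] by simp
  next
    fix a x
    have "(\<lambda>n. inner (v (r n)) (a *\<^sub>R x)) \<longlonglongrightarrow> a * f x"
      using tendsto_mult_left[OF f[of x], of a] by simp
    then show "f (a *\<^sub>R x) = a *\<^sub>R f x"
      using LIMSEQ_unique[OF f] by simp
  next
    fix x
    have "norm (inner (v (r n)) x) \<le> norm x * B" for n
    proof -
      have "norm (inner (v (r n)) x) \<le> norm (v (r n)) * norm x"
        using Cauchy_Schwarz_ineq2 by simp
      also have "\<dots> \<le> B * norm x"
        using bound by (intro mult_right_mono) auto
      finally show ?thesis by (simp add: mult.commute)
    qed
    then show "norm (f x) \<le> norm x * B"
      using LIMSEQ_le_const2[OF tendsto_norm[OF f[of x]]] by blast
  qed
  then obtain u where "\<And>x. f x = inner u x"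
    using Riesz_representation by blast
  then show ?thesis
    using that[OF r, of u] f by simp
qed

section \<open>Regularized fixed points of nonexpansive maps\<close>

text \<open>
  The map \<open>x \<mapsto> x - T x\<close> is monotone, and its Tikhonov regularizations
  \<open>u n - T (u n) = - \<tau> n * u n\<close> with \<open>\<tau> n = 1 / (n + 1)\<close> have
  solutions, since \<open>T / (1 + \<tau> n)\<close> is a contraction. Monotonicity compares two of
  them: \<open>\<langle>\<tau> n * u n - \<tau> m * u m, u n - u m\<rangle> \<le> 0\<close>. For
  \<open>n < m\<close> this yields
  \<open>\<parallel>u n - u m\<parallel>\<^sup>2 \<le> \<parallel>u m\<parallel>\<^sup>2 - \<parallel>u n\<parallel>\<^sup>2\<close>,
  so that the norms increase, and the sequence is Cauchy as soon as they are bounded.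
\<close>

lemma nonexpansive_fixpoint_or_blowup:
  fixes T :: "'a::{real_inner,complete_space} \<Rightarrow> 'a"
  assumes nonexp: "\<And>x y. norm (T x - T y) \<le> norm (x - y)"
  obtains (fixpoint) u where "T u = u"
  | (blowup) u where "\<And>n. T (u n) = (1 + 1 / real (Suc n)) *\<^sub>R u n"
      and "filterlim (\<lambda>n. norm (u n)) at_top sequentially"
proof -
  define \<tau> where "\<tau> n = 1 / real (Suc n)" for n
  have \<tau>_pos: "\<tau> n > 0" for n
    by (simp add: \<tau>_def)
  have \<tau>_strict: "\<tau> m < \<tau> n" if "n < m" for m n
    using that by (simp add: \<tau>_def field_simps)
  have "\<exists>x. T x = (1 + \<tau> n) *\<^sub>R x" for n
  proof -
    define c where "c = 1 / (1 + \<tau> n)"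
    have c: "0 \<le> c" "c < 1" "(1 + \<tau> n) * c = 1"
      using \<tau>_pos[of n] by (auto simp: c_def)
    have "\<exists>!x. c *\<^sub>R T x = x"
    proof (rule banach_fix_type[OF c(1,2)], intro allI)
      fix x y
      show "dist (c *\<^sub>R T x) (c *\<^sub>R T y) \<le> c * dist x y"
        using nonexp[of x y] c(1) by (simp add: dist_norm mult_left_mono flip: scaleR_diff_right)
    qed
    then obtain x where "c *\<^sub>R T x = x" by blast
    then have "(1 + \<tau> n) *\<^sub>R x = ((1 + \<tau> n) * c) *\<^sub>R T x"
      by (metis scaleR_scaleR)
    then show ?thesis
      using c(3) by (metis scaleR_one)
  qed
  then obtain u where u: "\<And>n. T (u n) = (1 + \<tau> n) *\<^sub>R u n"
    by metis
  have key: "(norm (u n - u m))\<^sup>2 \<le> (norm (u m))\<^sup>2 - (norm (u n))\<^sup>2" if "n < m" for n m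
  proof -
    define d where "d = u n - u m"
    have "inner (T (u n) - T (u m)) d \<le> norm (T (u n) - T (u m)) * norm d"
      by (rule norm_cauchy_schwarz)
    also have "\<dots> \<le> (norm d)\<^sup>2"
      using nonexp[of "u n" "u m"] by (simp add: d_def power2_eq_square mult_right_mono)
    finally have "inner (\<tau> n *\<^sub>R u n - \<tau> m *\<^sub>R u m) d \<le> 0"
      by (simp add: u scaleR_left_distrib d_def power2_norm_eq_inner inner_simps algebra_simps)
    moreover have "2 * inner (\<tau> n *\<^sub>R u n - \<tau> m *\<^sub>R u m) d =
        (\<tau> n + \<tau> m) * (norm d)\<^sup>2 - (\<tau> n - \<tau> m) * ((norm (u m))\<^sup>2 - (norm (u n))\<^sup>2)"
      unfolding d_def power2_norm_eq_inner
      by (simp add: inner_simps inner_commute algebra_simps)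
    ultimately have le: "(\<tau> n + \<tau> m) * (norm d)\<^sup>2 \<le>
        (\<tau> n - \<tau> m) * ((norm (u m))\<^sup>2 - (norm (u n))\<^sup>2)"
      by linarith
    have "0 \<le> (\<tau> n - \<tau> m) * ((norm (u m))\<^sup>2 - (norm (u n))\<^sup>2)"
      using le \<tau>_pos[of n] \<tau>_pos[of m] by (smt (verit) mult_nonneg_nonneg zero_le_power2)
    then have nonneg: "0 \<le> (norm (u m))\<^sup>2 - (norm (u n))\<^sup>2"
      using \<tau>_strict[OF that] by (simp add: zero_le_mult_iff)
    have "(\<tau> n - \<tau> m) * ((norm (u m))\<^sup>2 - (norm (u n))\<^sup>2) \<le>
        (\<tau> n + \<tau> m) * ((norm (u m))\<^sup>2 - (norm (u n))\<^sup>2)"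
      using nonneg \<tau>_pos[of m] by (intro mult_right_mono) auto
    with le have "(\<tau> n + \<tau> m) * (norm d)\<^sup>2 \<le> (\<tau> n + \<tau> m) * ((norm (u m))\<^sup>2 - (norm (u n))\<^sup>2)"
      by linarith
    then show ?thesis
      using \<tau>_pos[of n] \<tau>_pos[of m] by (simp add: d_def)
  qed
  define q where "q n = (norm (u n))\<^sup>2" for n
  have "mono q"
  proof (rule incseq_SucI)
    show "q n \<le> q (Suc n)" for n
      using key[of n "Suc n"] zero_le_power2[of "norm (u n - u (Suc n))"]
      unfolding q_def by linarith
  qed
  show ?thesis
  proof (cases "bdd_above (range q)")
    case True
    then have "Cauchy q"
      using \<open>mono q\<close> by (intro convergent_Cauchy) (metis LIMSEQ_incseq_SUP convergentI)
    have "Cauchy u"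
    proof (rule metric_CauchyI)
      fix e :: real assume "e > 0"
      then obtain n0 where n0: "\<And>i j. i \<ge> n0 \<Longrightarrow> j \<ge> n0 \<Longrightarrow> dist (q i) (q j) < e\<^sup>2"
        using \<open>Cauchy q\<close> metric_CauchyD[of q "e\<^sup>2"] by (metis zero_less_power)
      have less: "dist (u i) (u j) < e" if "i \<ge> n0" "i < j" for i j
      proof -
        have "(norm (u i - u j))\<^sup>2 < e\<^sup>2"
          using key[OF that(2)] n0[of i j] that unfolding q_def dist_real_def by linarith
        then show ?thesis
          using \<open>e > 0\<close> by (simp add: dist_norm power_less_imp_less_base)
      qed
      show "\<exists>M. \<forall>i\<ge>M. \<forall>j\<ge>M. dist (u i) (u j) < e"
        using less \<open>e > 0\<close> by (metis dist_commute dist_self linorder_neqE_nat)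
    qed
    then obtain z where z: "u \<longlonglongrightarrow> z"
      using Cauchy_convergent_iff convergent_def by blast
    have "(\<lambda>n. norm (u n - z)) \<longlonglongrightarrow> 0"
      using z by (rule tendsto_norm_zero[OF LIM_zero])
    then have "(\<lambda>n. T (u n) - T z) \<longlonglongrightarrow> 0"
      by (rule Lim_null_comparison[rotated]) (simp add: nonexp)
    then have 1: "(\<lambda>n. T (u n)) \<longlonglongrightarrow> T z"
      by (rule LIM_zero_cancel)
    have "\<tau> \<longlonglongrightarrow> 0"
      using LIMSEQ_inverse_real_of_nat by (simp add: \<tau>_def[abs_def] inverse_eq_divide)
    then have "(\<lambda>n. (1 + \<tau> n) *\<^sub>R u n) \<longlonglongrightarrow> (1 + 0) *\<^sub>R z"
      using z by (intro tendsto_intros)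
    then have "T z = z"
      using LIMSEQ_unique[OF 1] by (simp add: u)
    then show ?thesis by (rule fixpoint)
  next
    case False
    have "filterlim (\<lambda>n. norm (u n)) at_top sequentially"
      unfolding filterlim_at_top eventually_sequentially
    proof
      fix Z :: real
      obtain n0 where n0: "q n0 > Z\<^sup>2"
        using False unfolding bdd_above_def by (metis image_iff linorder_not_le)
      have "Z \<le> norm (u n)" if "n \<ge> n0" for n
      proof -
        have "Z\<^sup>2 \<le> (norm (u n))\<^sup>2"
          using n0 monoD[OF \<open>mono q\<close> that] unfolding q_def by linarith
        then show ?thesis
          by (rule power2_le_imp_le) simp
      qed
      then show "\<exists>n0. \<forall>n\<ge>n0. Z \<le> norm (u n)" by blast
    qed
    then show ?thesis
      using blowup u unfolding \<tau>_def by blast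
  qed
qed

section \<open>Self-adjoint operators through the real inner product\<close>

lemma Re_cinner: "Re (cinner x y) = inner x y"
  by (simp add: inner_eq_Re_cinner)

lemma Im_cinner: "Im (cinner x y) = - inner (\<i> *\<^sub>C x) y"
  by (simp add: inner_eq_Re_cinner cinner_scaleC_left)

text \<open>
  By this rule an identity between complex inner products that holds on a complex subspace can be
  checked on real inner products, since the subspace contains \<open>\<i> *\<^sub>C x\<close> with
  \<open>x\<close>.
\<close>

lemma cinner_eq_iff_inner:
  "cinner x y = cinner x' y' \<longleftrightarrow>
     inner x y = inner x' y' \<and> inner (\<i> *\<^sub>C x) y = inner (\<i> *\<^sub>C x') y'"
  by (simp add: complex_eq_iff Re_cinner Im_cinner)

lemma weakly_tendsto_iff_inner:
  "weakly_tendsto v u \<longleftrightarrow> (\<forall>w. (\<lambda>k. inner (v k) w) \<longlonglongrightarrow> inner u w)"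
proof
  assume "weakly_tendsto v u"
  then show "\<forall>w. (\<lambda>k. inner (v k) w) \<longlonglongrightarrow> inner u w"
    unfolding weakly_tendsto_def Re_cinner[symmetric] by (intro allI tendsto_Re) simp
next
  assume lim: "\<forall>w. (\<lambda>k. inner (v k) w) \<longlonglongrightarrow> inner u w"
  have Im: "Im (cinner x w) = inner x (\<i> *\<^sub>C w)" for x w :: 'a
    using Im_cinner[of w x] cinner_commute[of x w] by (simp add: inner_commute)
  show "weakly_tendsto v u"
    using lim unfolding weakly_tendsto_def tendsto_complex_iff by (simp add: Re_cinner Im)
qed

lemma
  assumes "linear_operator D L"
  shows linear_operator_scaleR: "u \<in> D \<Longrightarrow> a *\<^sub>R u \<in> D" "u \<in> D \<Longrightarrow> L (a *\<^sub>R u) = a *\<^sub>R L u"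
    and linear_operator_diff: "u \<in> D \<Longrightarrow> v \<in> D \<Longrightarrow> u - v \<in> D"
      "u \<in> D \<Longrightarrow> v \<in> D \<Longrightarrow> L (u - v) = L u - L v"
proof -
  have D: "complex_vector.subspace D"
    and add: "\<And>u v. u \<in> D \<Longrightarrow> v \<in> D \<Longrightarrow> L (u + v) = L u + L v"
    and scale: "\<And>c u. u \<in> D \<Longrightarrow> L (c *\<^sub>C u) = c *\<^sub>C L u"
    using assms unfolding linear_operator_def by auto
  show "u \<in> D \<Longrightarrow> a *\<^sub>R u \<in> D"
    unfolding scaleR_scaleC using D complex_vector.subspace_scale by blast
  show "u \<in> D \<Longrightarrow> L (a *\<^sub>R u) = a *\<^sub>R L u"
    unfolding scaleR_scaleC by (rule scale)
  show diff: "u \<in> D \<Longrightarrow> v \<in> D \<Longrightarrow> u - v \<in> D"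
    using D complex_vector.subspace_diff by blast
  show "u \<in> D \<Longrightarrow> v \<in> D \<Longrightarrow> L (u - v) = L u - L v"
    using add[of "u - v" v] diff by simp
qed

text \<open>
  The graph of \<open>L\<close> is cut out by conditions that are weakly continuous in
  \<open>(v, w)\<close>. The direction from left to right is symmetry of \<open>L\<close>; the other
  one is maximality. Both rest on density of the domain, by which \<open>w\<close> is unique.
\<close>

lemma self_adjoint_graph_iff:
  assumes "self_adjoint D L"
  shows "v \<in> D \<and> L v = w \<longleftrightarrow> (\<forall>u\<in>D. inner (L u) v = inner u w)"
proof -
  have D: "complex_vector.subspace D" and dense: "closure D = UNIV"
    and scale: "\<And>c u. u \<in> D \<Longrightarrow> L (c *\<^sub>C u) = c *\<^sub>C L u"
    and dom: "adjoint_dom D L = D" and op: "\<And>v. v \<in> D \<Longrightarrow> adjoint_op D L v = L v"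
    using assms unfolding self_adjoint_def linear_operator_def by auto
  have real_iff: "(\<forall>u\<in>D. cinner (L u) v = cinner u w) \<longleftrightarrow> (\<forall>u\<in>D. inner (L u) v = inner u w)"
    for v w
  proof -
    have "\<i> *\<^sub>C u \<in> D" "L (\<i> *\<^sub>C u) = \<i> *\<^sub>C L u" if "u \<in> D" for u
      using that scale complex_vector.subspace_scale[OF D] by auto
    then show ?thesis
      unfolding cinner_eq_iff_inner by fastforce
  qed
  have unique: "w = w'" if "\<forall>u\<in>D. cinner (L u) v = cinner u w"
    "\<forall>u\<in>D. cinner (L u) v = cinner u w'" for v w w'
  proof -
    have "\<forall>u\<in>D. inner u (w - w') = 0"
      using that unfolding real_iff by (simp add: inner_diff_right)
    then have "D \<subseteq> {u. inner u (w - w') = 0}"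
      by blast
    moreover have "closed {u. inner u (w - w') = 0}"
      by (intro closed_Collect_eq continuous_intros)
    ultimately have "closure D \<subseteq> {u. inner u (w - w') = 0}"
      by (rule closure_minimal)
    then have "inner (w - w') (w - w') = 0"
      using dense by blast
    then show ?thesis by simp
  qed
  have adj: "\<forall>u\<in>D. cinner (L u) v = cinner u (L v)" if "v \<in> D" for v
  proof -
    have "v \<in> adjoint_dom D L"
      using that dom by simp
    then obtain w where w: "\<forall>u\<in>D. cinner (L u) v = cinner u w"
      unfolding adjoint_dom_def by blast
    then have "adjoint_op D L v = w"
      unfolding adjoint_op_def by (rule the_equality) (rule unique[OF _ w])
    then show ?thesis
      using w op[OF that] by simp
  qed
  show ?thesis
    unfolding real_iff[symmetric]
  proof
    assume w: "\<forall>u\<in>D. cinner (L u) v = cinner u w"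
    then have "v \<in> adjoint_dom D L"
      unfolding adjoint_dom_def by blast
    then have "v \<in> D"
      using dom by simp
    then show "v \<in> D \<and> L v = w"
      using unique[OF adj w] by simp
  qed (use adj in blast)
qed

lemma self_adjoint_weakly_closed:
  assumes "self_adjoint D L" and "\<And>n. v n \<in> D"
    and "weakly_tendsto v u" and "weakly_tendsto (\<lambda>n. L (v n)) w"
  shows "u \<in> D" and "L u = w"
proof -
  have "inner (L x) u = inner x w" if "x \<in> D" for x
  proof (rule LIMSEQ_unique)
    show "(\<lambda>n. inner (L x) (v n)) \<longlonglongrightarrow> inner (L x) u"
      using assms(3) unfolding weakly_tendsto_iff_inner inner_commute[of "L x"] by blast
    have "inner (L x) (v n) = inner x (L (v n))" for n
      using self_adjoint_graph_iff[OF assms(1)] assms(2) that by blast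
    then show "(\<lambda>n. inner (L x) (v n)) \<longlonglongrightarrow> inner x w"
      using assms(4) unfolding weakly_tendsto_iff_inner inner_commute[of x] by simp
  qed
  then have "u \<in> D \<and> L u = w"
    unfolding self_adjoint_graph_iff[OF assms(1)] by blast
  then show "u \<in> D" and "L u = w" by auto
qed

section \<open>Quadratic form bounds from spectral gaps\<close>

lemma real_resolventE:
  assumes "complex_of_real c \<in> resolvent_set D L"
  obtains A where "bounded_linear A" and "\<And>y. A y \<in> D" and "\<And>y. L (A y) - c *\<^sub>R A y = y"
    and "\<And>u. u \<in> D \<Longrightarrow> A (L u - c *\<^sub>R u) = u"
proof
  let ?f = "\<lambda>u. L u - complex_of_real c *\<^sub>C u"
  have bij: "bij_betw ?f D UNIV" and bl: "bounded_linear (inv_into D ?f)"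
    using assms unfolding resolvent_set_def by auto
  show "bounded_linear (inv_into D ?f)" by fact
  show "inv_into D ?f y \<in> D" for y
    using bij bij_betw_imp_surj_on inv_into_into by (metis UNIV_I)
  show "L (inv_into D ?f y) - c *\<^sub>R inv_into D ?f y = y" for y
    using bij_betw_inv_into_right[OF bij, of y] by (simp add: scaleR_scaleC)
  show "inv_into D ?f (L u - c *\<^sub>R u) = u" if "u \<in> D" for u
    using bij_betw_inv_into_left[OF bij that] by (simp add: scaleR_scaleC)
qed

text \<open>
  The operator \<open>A = (L - c)\<^sup>-\<^sup>1\<close> is bounded and symmetric, so that, in a
  nonzero space, \<open>\<parallel>A\<parallel>\<close> or \<open>- \<parallel>A\<parallel>\<close>
  is a spectral value of \<open>A\<close>, which forces
  \<open>\<parallel>A\<parallel> \<le> 1 / r\<close>. Explicitly, suppose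
  \<open>M = \<parallel>A\<parallel> > 1 / r\<close>. Then \<open>c + 1 / M\<close> and
  \<open>c - 1 / M\<close> lie in the resolvent set of \<open>L\<close>, so that
  \<open>A - M\<close> and \<open>A + M\<close> are bounded below, hence also their product
  \<open>A\<^sup>2 - M\<^sup>2\<close>, by some \<open>k > 0\<close>. But
  \<open>\<parallel>A\<^sup>2 y - M\<^sup>2 y\<parallel>\<^sup>2 \<le> M\<^sup>2 * (M\<^sup>2 * \<parallel>y\<parallel>\<^sup>2 - \<parallel>A y\<parallel>\<^sup>2)\<close>
  by symmetry, and this keeps \<open>\<parallel>A y\<parallel>\<close> below a constant multiple of
  \<open>\<parallel>y\<parallel>\<close> with constant less than \<open>M\<close>.
\<close>

lemma spectral_gap_lower_bound:
  assumes sa: "self_adjoint D L" and "r > 0"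
    and gap: "\<And>x. c - r < x \<Longrightarrow> x < c + r \<Longrightarrow> complex_of_real x \<in> resolvent_set D L"
    and "u \<in> D"
  shows "r * norm u \<le> norm (L u - c *\<^sub>R u)"
proof -
  have "complex_of_real c \<in> resolvent_set D L"
    using \<open>r > 0\<close> by (intro gap) auto
  then obtain A where A: "bounded_linear A" and A_D: "\<And>y. A y \<in> D"
    and LA: "\<And>y. L (A y) - c *\<^sub>R A y = y" and AL: "\<And>u. u \<in> D \<Longrightarrow> A (L u - c *\<^sub>R u) = u"
    by (rule real_resolventE) blast
  interpret A: bounded_linear A by (rule A)
  define M where "M = onorm A"
  have AM: "norm (A y) \<le> M * norm y" for y
    unfolding M_def by (rule onorm[OF A])
  have sym: "inner (A x) y = inner x (A y)" for x y
  proof -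
    have "inner (L (A x)) (A y) = inner (A x) (L (A y))"
      using self_adjoint_graph_iff[OF sa] A_D by blast
    moreover have "L (A z) = z + c *\<^sub>R A z" for z
      using LA[of z] by (simp add: algebra_simps)
    ultimately show ?thesis
      by (simp add: inner_simps)
  qed
  have "M \<le> 1 / r"
  proof (rule ccontr)
    assume "\<not> M \<le> 1 / r"
    then have "1 / r < M" by simp
    moreover have "0 < 1 / r"
      using \<open>r > 0\<close> by simp
    ultimately have "M > 0"
      by linarith
    then have "1 / M < r"
      using \<open>1 / r < M\<close> \<open>r > 0\<close> by (simp add: field_simps)
    have below: "\<exists>k>0. \<forall>y. k * norm y \<le> norm (A y - \<mu> *\<^sub>R y)" if \<mu>: "\<bar>\<mu>\<bar> = M" for \<mu>
    proof -
      have "\<bar>1 / \<mu>\<bar> < r"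
        using \<mu> \<open>1 / M < r\<close> by simp
      then have "complex_of_real (c + 1 / \<mu>) \<in> resolvent_set D L"
        by (intro gap) linarith+
      then obtain A' where A': "bounded_linear A'"
        and AL': "\<And>u. u \<in> D \<Longrightarrow> A' (L u - (c + 1 / \<mu>) *\<^sub>R u) = u"
        by (rule real_resolventE) blast
      obtain K where K: "K > 0" "\<And>x. norm (A' x) \<le> norm x * K"
        using bounded_linear.pos_bounded[OF A'] by blast
      have "M / (K / M + 1) * norm y \<le> norm (A y - \<mu> *\<^sub>R y)" for y
      proof -
        have "\<mu> \<noteq> 0"
          using \<mu> \<open>M > 0\<close> by auto
        have "L (A y) - (c + 1 / \<mu>) *\<^sub>R A y = (L (A y) - c *\<^sub>R A y) - (1 / \<mu>) *\<^sub>R A y"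
          by (simp add: scaleR_left_distrib)
        also have "\<dots> = - (1 / \<mu>) *\<^sub>R (A y - \<mu> *\<^sub>R y)"
          using \<open>\<mu> \<noteq> 0\<close> by (simp add: LA scaleR_diff_right)
        finally have "A y = A' (- (1 / \<mu>) *\<^sub>R (A y - \<mu> *\<^sub>R y))"
          using AL'[OF A_D, of y] by simp
        then have "norm (A y) \<le> norm (- (1 / \<mu>) *\<^sub>R (A y - \<mu> *\<^sub>R y)) * K"
          using K(2) by metis
        then have "norm (A y) \<le> K / M * norm (A y - \<mu> *\<^sub>R y)"
          using \<mu> by (simp add: mult.commute)
        moreover have "M * norm y \<le> norm (A y) + norm (A y - \<mu> *\<^sub>R y)"
          using norm_triangle_ineq4[of "A y" "A y - \<mu> *\<^sub>R y"] \<mu> by simp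
        ultimately have "M * norm y \<le> (K / M + 1) * norm (A y - \<mu> *\<^sub>R y)"
          by (simp add: distrib_right)
        moreover have "K / M + 1 > 0"
          using K(1) \<open>M > 0\<close> by (simp add: add_pos_pos)
        ultimately show ?thesis
          by (simp add: pos_divide_le_eq mult.commute)
      qed
      moreover have "M / (K / M + 1) > 0"
        using K(1) \<open>M > 0\<close> by (simp add: add_pos_pos)
      ultimately show ?thesis by blast
    qed
    obtain k1 where k1: "k1 > 0" "\<And>y. k1 * norm y \<le> norm (A y - M *\<^sub>R y)"
      using below[of M] \<open>M > 0\<close> by auto
    obtain k2 where k2: "k2 > 0" "\<And>y. k2 * norm y \<le> norm (A y + M *\<^sub>R y)"
      using below[of "- M"] \<open>M > 0\<close> by auto
    define k where "k = k1 * k2"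
    have "k > 0"
      using k1 k2 by (simp add: k_def)
    \<comment> \<open>The maximum only ensures that the bound is nonnegative, also in the trivial space.\<close>
    define q where "q = max 0 (M\<^sup>2 - k\<^sup>2 / M\<^sup>2)"
    have "norm (A y) \<le> sqrt q * norm y" for y
    proof -
      have "k * norm y \<le> k1 * norm (A y + M *\<^sub>R y)"
        using k2(2)[of y] k1(1) by (simp add: k_def mult.assoc)
      also have "\<dots> \<le> norm (A (A y + M *\<^sub>R y) - M *\<^sub>R (A y + M *\<^sub>R y))"
        by (rule k1(2))
      also have "\<dots> = norm (A (A y) - M\<^sup>2 *\<^sub>R y)"
        by (simp add: A.add A.scaleR algebra_simps power2_eq_square)
      finally have "(k * norm y)\<^sup>2 \<le> (norm (A (A y) - M\<^sup>2 *\<^sub>R y))\<^sup>2"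
        using \<open>k > 0\<close> by (intro power_mono) auto
      also have "\<dots> = (norm (A (A y)))\<^sup>2 - 2 * M\<^sup>2 * inner (A (A y)) y + (M\<^sup>2)\<^sup>2 * (norm y)\<^sup>2"
        unfolding power2_norm_eq_inner
        by (simp add: inner_simps inner_commute algebra_simps power2_eq_square)
      also have "inner (A (A y)) y = (norm (A y))\<^sup>2"
        by (simp add: sym power2_norm_eq_inner)
      also have "(norm (A (A y)))\<^sup>2 \<le> (M * norm (A y))\<^sup>2"
        by (intro power_mono AM) auto
      finally have "k\<^sup>2 * (norm y)\<^sup>2 \<le> M\<^sup>2 * (M\<^sup>2 * (norm y)\<^sup>2 - (norm (A y))\<^sup>2)"
        by (simp add: power_mult_distrib algebra_simps power2_eq_square)
      then have "(norm (A y))\<^sup>2 \<le> (M\<^sup>2 - k\<^sup>2 / M\<^sup>2) * (norm y)\<^sup>2"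
        using \<open>M > 0\<close> by (simp add: field_simps)
      also have "\<dots> \<le> q * (norm y)\<^sup>2"
        by (intro mult_right_mono) (auto simp: q_def)
      finally have "(norm (A y))\<^sup>2 \<le> q * (norm y)\<^sup>2" .
      then have "sqrt ((norm (A y))\<^sup>2) \<le> sqrt (q * (norm y)\<^sup>2)"
        by (rule real_sqrt_le_mono)
      then show ?thesis
        by (simp add: real_sqrt_mult)
    qed
    moreover have "0 \<le> sqrt q"
      by (simp add: q_def)
    ultimately have "M \<le> sqrt q"
      unfolding M_def by (intro onorm_bound) auto
    then have "sqrt (M\<^sup>2) \<le> sqrt q"
      using \<open>M > 0\<close> by simp
    then have "M\<^sup>2 \<le> q"
      by (simp only: real_sqrt_le_iff)
    then show False
      using \<open>k > 0\<close> \<open>M > 0\<close> by (simp add: q_def le_max_iff_disj divide_le_0_iff)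
  qed
  have "norm u \<le> M * norm (L u - c *\<^sub>R u)"
    using AM[of "L u - c *\<^sub>R u"] unfolding AL[OF \<open>u \<in> D\<close>] .
  also have "\<dots> \<le> 1 / r * norm (L u - c *\<^sub>R u)"
    using \<open>M \<le> 1 / r\<close> by (intro mult_right_mono) auto
  finally show ?thesis
    using \<open>r > 0\<close> by (simp add: field_simps)
qed

text \<open>
  The form analogue of \<open>\<lambda> * (\<lambda> + d) \<ge> 0\<close> for real
  \<open>\<lambda>\<close> outside \<open>(-d, 0)\<close>: it is the square of the lower bound
  around the midpoint \<open>- d / 2\<close>.
\<close>

lemma spectral_gap_form_bound:
  assumes "self_adjoint D L" and "d > 0"
    and "complex_of_real ` {-d<..<0} \<subseteq> resolvent_set D L" and "u \<in> D"
  shows "0 \<le> (norm (L u))\<^sup>2 + d * inner (L u) u"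
proof -
  have "d / 2 * norm u \<le> norm (L u - (- d / 2) *\<^sub>R u)"
    using \<open>d > 0\<close> \<open>u \<in> D\<close>
    by (intro spectral_gap_lower_bound[OF assms(1)] subsetD[OF assms(3)] imageI) auto
  then have "(d / 2 * norm u)\<^sup>2 \<le> (norm (L u - (- d / 2) *\<^sub>R u))\<^sup>2"
    using \<open>d > 0\<close> by (intro power_mono) auto
  also have "\<dots> = (norm (L u))\<^sup>2 + d * inner (L u) u + (d / 2 * norm u)\<^sup>2"
    unfolding power_mult_distrib power2_norm_eq_inner
    by (simp add: inner_simps inner_commute field_simps power2_eq_square)
  finally show ?thesis by simp
qed

text \<open>
  If \<open>\<gamma> < \<delta>\<close>, the gap and the lower bound \<open>- \<gamma>\<close> of
  the spectrum together cover the whole negative half-line, and \<open>L\<close> is nonnegative. If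
  \<open>\<gamma> \<ge> \<delta>\<close>, then
  \<open>\<gamma> / \<delta>\<^sup>2 \<ge> 1 / \<delta>\<close>, and the gap alone suffices.
\<close>

lemma spectral_gap_consequences:
  assumes sa: "self_adjoint D L" and "\<delta> > 0"
    and gap: "complex_of_real ` {-\<delta><..<0} \<subseteq> resolvent_set D L"
    and "\<gamma> \<ge> 0" and inf: "(INF z\<in>spectrum D L. ereal (Re z)) = ereal (- \<gamma>)"
  shows "u \<in> D \<Longrightarrow> - (\<gamma> / \<delta>\<^sup>2) * (norm (L u))\<^sup>2 \<le> inner (L u) u"
    and "0 < s \<Longrightarrow> 2 * s * \<gamma> \<le> \<delta>\<^sup>2 \<Longrightarrow> complex_of_real (- s) \<in> resolvent_set D L"
proof -
  have below: "complex_of_real x \<in> resolvent_set D L" if "x < - \<gamma>" for x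
  proof (rule ccontr)
    assume "complex_of_real x \<notin> resolvent_set D L"
    then have "complex_of_real x \<in> spectrum D L"
      by (simp add: spectrum_def)
    then have "ereal (- \<gamma>) \<le> ereal (Re (complex_of_real x))"
      unfolding inf[symmetric] by (rule INF_lower)
    then show False
      using that by simp
  qed
  have neg: "complex_of_real x \<in> resolvent_set D L" if "\<gamma> < \<delta>" "x < 0" for x
    using below[of x] gap that by (cases "x < - \<gamma>") auto
  show "- (\<gamma> / \<delta>\<^sup>2) * (norm (L u))\<^sup>2 \<le> inner (L u) u" if "u \<in> D"
  proof (cases "\<gamma> < \<delta>")
    case True
    have "0 \<le> inner (L u) u"
    proof (rule ccontr)
      assume "\<not> 0 \<le> inner (L u) u"
      then have "inner (L u) u < 0" by simp
      \<comment> \<open>All gaps \<open>(-d, 0)\<close> are available here; this one is wide enough to contradict the bound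
        on the form.\<close>
      define d where "d = ((norm (L u))\<^sup>2 + 1) / - inner (L u) u"
      have "d > 0"
        using \<open>inner (L u) u < 0\<close> unfolding d_def
        by (intro divide_pos_pos add_nonneg_pos) auto
      have "d * inner (L u) u = - ((norm (L u))\<^sup>2 + 1)"
        using \<open>inner (L u) u < 0\<close> by (simp add: d_def)
      moreover have "0 \<le> (norm (L u))\<^sup>2 + d * inner (L u) u"
        using neg[OF True] by (intro spectral_gap_form_bound[OF sa \<open>d > 0\<close> _ that]) auto
      ultimately show False by linarith
    qed
    moreover have "0 \<le> \<gamma> / \<delta>\<^sup>2 * (norm (L u))\<^sup>2"
      using \<open>\<gamma> \<ge> 0\<close> by simp
    ultimately show ?thesis by simp
  next
    case False
    then have "1 / \<delta> \<le> \<gamma> / \<delta>\<^sup>2"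
      using \<open>\<delta> > 0\<close> by (simp add: field_simps power2_eq_square)
    then have "1 / \<delta> * (norm (L u))\<^sup>2 \<le> \<gamma> / \<delta>\<^sup>2 * (norm (L u))\<^sup>2"
      by (rule mult_right_mono) simp
    moreover have "0 \<le> 1 / \<delta> * (norm (L u))\<^sup>2 + inner (L u) u"
      using spectral_gap_form_bound[OF sa \<open>\<delta> > 0\<close> gap that] \<open>\<delta> > 0\<close>
      by (simp add: field_simps)
    ultimately show ?thesis by simp
  qed
  show "complex_of_real (- s) \<in> resolvent_set D L" if "0 < s" "2 * s * \<gamma> \<le> \<delta>\<^sup>2"
  proof (cases "\<gamma> < \<delta>")
    case True
    then show ?thesis
      using neg[OF True, of "- s"] that by simp
  next
    case False
    then have "2 * s * \<delta> \<le> 2 * s * \<gamma>"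
      using that by (intro mult_left_mono) auto
    also have "\<dots> \<le> \<delta> * \<delta>"
      using that(2) unfolding power2_eq_square .
    finally have "(2 * s) * \<delta> \<le> \<delta> * \<delta>" .
    then have "2 * s \<le> \<delta>"
      using \<open>\<delta> > 0\<close> by simp
    then show ?thesis
      using gap that by (intro subsetD[OF gap] imageI) auto
  qed
qed

section \<open>Excluding blow-up\<close>

text \<open>
  Here \<open>l\<close> and \<open>p\<close> stand for \<open>L u\<close> and \<open>N u\<close>.
  Testing the equation with \<open>u\<close> leaves the negative part
  \<open>- \<beta> * \<parallel>l\<parallel>\<^sup>2\<close> of the form. It is controlled by
  substituting \<open>h - p - \<sigma> u\<close> for \<open>(1 + \<tau>) l\<close>: the term
  \<open>\<parallel>p\<parallel>\<^sup>2\<close> that appears is at most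
  \<open>\<langle>p, u\<rangle> / \<alpha>\<close> and is absorbed on the left, which costs the
  factor \<open>1 - \<beta> / \<alpha>\<close>.
\<close>

lemma energy_estimate:
  fixes l p u h :: "'a::real_inner"
  assumes "\<beta> \<ge> 0" and "\<alpha> > 0" and form: "- \<beta> * (norm l)\<^sup>2 \<le> inner l u"
    and coc: "\<alpha> * (norm p)\<^sup>2 \<le> inner p u"
    and eq: "(1 + \<tau>) *\<^sub>R l + \<sigma> *\<^sub>R u + p = h"
    and "\<tau> \<ge> 0" and "\<sigma> \<ge> 0" and "\<beta> * \<sigma> \<le> 1"
  shows "(1 - \<beta> / \<alpha> - 2 * \<beta> * \<sigma>) * inner p u \<le>
    inner h u + \<beta> * ((norm h)\<^sup>2 + 2 * norm h * norm p + 2 * \<sigma> * norm h * norm u)"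
proof -
  define w where "w = (1 + \<tau>) *\<^sub>R l"
  have w: "w = h - p - \<sigma> *\<^sub>R u"
    using eq by (simp add: w_def algebra_simps)
  have "inner w u \<ge> - \<beta> * (norm w)\<^sup>2"
  proof -
    have "- \<beta> * (norm w)\<^sup>2 = (1 + \<tau>) * ((1 + \<tau>) * (- \<beta> * (norm l)\<^sup>2))"
      by (simp add: w_def power_mult_distrib power2_eq_square)
    \<comment> \<open>The factor \<open>1 + \<tau> \<ge> 1\<close> may be dropped because \<open>- \<beta> * \<parallel>l\<parallel>\<^sup>2\<close> is nonpositive.\<close>
    also have "\<dots> \<le> (1 + \<tau>) * (1 * (- \<beta> * (norm l)\<^sup>2))"
      using \<open>\<tau> \<ge> 0\<close> \<open>\<beta> \<ge> 0\<close> by (intro mult_left_mono mult_right_mono_neg) auto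
    also have "\<dots> \<le> (1 + \<tau>) * inner l u"
      using form \<open>\<tau> \<ge> 0\<close> by (intro mult_left_mono) auto
    finally show ?thesis by (simp add: w_def)
  qed
  moreover have "inner w u + \<sigma> * (norm u)\<^sup>2 + inner p u = inner h u"
    by (simp add: w inner_simps power2_norm_eq_inner)
  ultimately have 1: "inner p u \<le> inner h u - \<sigma> * (norm u)\<^sup>2 + \<beta> * (norm w)\<^sup>2"
    by linarith
  have "(norm w)\<^sup>2 = (norm h)\<^sup>2 + (norm p)\<^sup>2 + \<sigma>\<^sup>2 * (norm u)\<^sup>2
      - 2 * inner h p - 2 * \<sigma> * inner h u + 2 * \<sigma> * inner p u"
    unfolding w power2_norm_eq_inner
    by (simp add: inner_simps inner_commute algebra_simps power2_eq_square)
  moreover have "(norm p)\<^sup>2 \<le> inner p u / \<alpha>"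
    using coc \<open>\<alpha> > 0\<close> by (simp add: field_simps)
  moreover have "- inner h p \<le> norm h * norm p"
    using Cauchy_Schwarz_ineq2[of h p] by linarith
  moreover have "\<sigma> * (- inner h u) \<le> \<sigma> * (norm h * norm u)"
    using Cauchy_Schwarz_ineq2[of h u] \<open>\<sigma> \<ge> 0\<close> by (intro mult_left_mono) linarith+
  ultimately have "(norm w)\<^sup>2 \<le> (norm h)\<^sup>2 + inner p u / \<alpha> + \<sigma>\<^sup>2 * (norm u)\<^sup>2
      + 2 * norm h * norm p + 2 * \<sigma> * norm h * norm u + 2 * \<sigma> * inner p u"
    by (simp add: mult.assoc)
  then have "\<beta> * (norm w)\<^sup>2 \<le> \<beta> * ((norm h)\<^sup>2 + inner p u / \<alpha> + \<sigma>\<^sup>2 * (norm u)\<^sup>2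
      + 2 * norm h * norm p + 2 * \<sigma> * norm h * norm u + 2 * \<sigma> * inner p u)"
    using \<open>\<beta> \<ge> 0\<close> by (rule mult_left_mono)
  moreover have "\<beta> * (\<sigma>\<^sup>2 * (norm u)\<^sup>2) \<le> \<sigma> * (norm u)\<^sup>2"
    using mult_right_mono[OF \<open>\<beta> * \<sigma> \<le> 1\<close>, of "\<sigma> * (norm u)\<^sup>2"] \<open>\<sigma> \<ge> 0\<close>
    by (simp add: power2_eq_square mult_ac)
  ultimately show ?thesis
    using 1 by (simp add: algebra_simps)
qed

text \<open>
  After dividing by \<open>\<parallel>u n\<parallel>\<close>, the energy estimate first bounds
  \<open>\<langle>N (u n), u n\<rangle> / \<parallel>u n\<parallel>\<close>. By cocoercivity
  \<open>\<parallel>N (u n)\<parallel>\<^sup>2\<close> is then of order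
  \<open>\<parallel>u n\<parallel>\<close>, so that
  \<open>N (u n) / \<parallel>u n\<parallel>\<close> tends to \<open>0\<close>. With this
  information the estimate is used a second time, now with all error terms vanishing, and is
  confronted with the growth and recession hypotheses along a weakly convergent subsequence of the
  normalized vectors.
\<close>

lemma bounded_along_regularization:
  fixes D :: "'a::complex_hilbert set"
  assumes separable: "separable_space (euclidean :: 'a topology)"
    and sa: "self_adjoint D L"
    and "0 \<le> \<beta>" and "\<beta> < \<alpha>" and "s \<ge> 0"
    and form: "\<And>u. u \<in> D \<Longrightarrow> - \<beta> * (norm (L u))\<^sup>2 \<le> inner (L u) u"
    and coc: "\<And>u. \<alpha> * (norm (N u))\<^sup>2 \<le> inner (N u) u"
    and growth: "\<And>u :: nat \<Rightarrow> 'a. filterlim (\<lambda>k. norm (u k)) at_top sequentially \<Longrightarrow>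
      limsup (\<lambda>k. ereal (Re (cinner (N (u k)) (u k)) / norm (u k))) > ereal (\<beta> * norm h / (\<alpha> - \<beta>))"
    and rec: "\<And>u. u \<in> op_kernel D L \<Longrightarrow> norm u = 1 \<Longrightarrow>
      recession N u > ereal (\<beta> * norm h / (\<alpha> - \<beta>) + Re (cinner h u))"
    and \<tau>: "\<And>n. 0 \<le> \<tau> n" "\<tau> \<longlonglongrightarrow> 0"
    and u: "\<And>n. u n \<in> D"
      "\<And>n. (1 + \<tau> n) *\<^sub>R L (u n) + (s * \<tau> n) *\<^sub>R u n + N (u n) = h"
  shows "\<not> filterlim (\<lambda>n. norm (u n)) at_top sequentially"
proof
  assume blowup: "filterlim (\<lambda>n. norm (u n)) at_top sequentially"
  have "\<alpha> > 0"
    using \<open>0 \<le> \<beta>\<close> \<open>\<beta> < \<alpha>\<close> by linarith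
  have lin: "linear_operator D L"
    using sa by (simp add: self_adjoint_def)
  define a where "a n = norm (u n)" for n
  define X where "X n = inner (N (u n)) (u n)" for n
  define \<sigma> where "\<sigma> n = s * \<tau> n" for n
  define \<kappa> where "\<kappa> = 1 - \<beta> / \<alpha>"
  have "\<kappa> > 0"
    using \<open>\<beta> < \<alpha>\<close> \<open>\<alpha> > 0\<close> by (simp add: \<kappa>_def)
  have \<sigma>_nonneg: "\<sigma> n \<ge> 0" for n
    using \<tau> \<open>s \<ge> 0\<close> by (simp add: \<sigma>_def)
  have \<sigma>_lim: "\<sigma> \<longlonglongrightarrow> 0"
    using tendsto_mult_left[OF \<tau>(2), of s] by (simp add: \<sigma>_def[abs_def])
  have X_nonneg: "X n \<ge> 0" for n
    using coc[of "u n"] \<open>\<alpha> > 0\<close> unfolding X_def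
    by (meson mult_nonneg_nonneg less_imp_le order_trans zero_le_power2)
  have N_le: "norm (N (u n)) \<le> a n / \<alpha>" for n
  proof -
    have "norm (N (u n)) * (\<alpha> * norm (N (u n))) \<le> norm (N (u n)) * a n"
      using coc[of "u n"] norm_cauchy_schwarz[of "N (u n)" "u n"]
      by (simp add: a_def power2_eq_square mult_ac)
    then have "\<alpha> * norm (N (u n)) \<le> a n"
      by (cases "N (u n) = 0") (auto simp: a_def)
    then show ?thesis
      using \<open>\<alpha> > 0\<close> by (simp add: field_simps)
  qed
  have inverse_a: "(\<lambda>n. 1 / a n) \<longlonglongrightarrow> 0"
    using tendsto_inverse_0_at_top[OF blowup] by (simp add: a_def inverse_eq_divide)
  have ev_a: "\<forall>\<^sub>F n in sequentially. a n \<ge> 1"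
    using blowup unfolding filterlim_at_top a_def by blast
  have "(\<lambda>n. 2 * \<beta> * \<sigma> n) \<longlonglongrightarrow> 0"
    using tendsto_mult_left[OF \<sigma>_lim, of "2 * \<beta>"] by simp
  then have ev_\<sigma>: "\<forall>\<^sub>F n in sequentially. 2 * \<beta> * \<sigma> n < min 1 (\<kappa> / 2)"
    using \<open>\<kappa> > 0\<close> by (intro order_tendstoD) auto
  have ev_\<sigma>1: "\<forall>\<^sub>F n in sequentially. \<sigma> n < 1"
    using \<sigma>_lim by (rule order_tendstoD) simp
  define C where "C = 2 / \<kappa> * (norm h + \<beta> * ((norm h)\<^sup>2 + 2 * norm h / \<alpha> + 2 * norm h))"
  have energy: "(\<kappa> - 2 * \<beta> * \<sigma> n) * X n \<le>
      inner h (u n) + \<beta> * ((norm h)\<^sup>2 + 2 * norm h * norm (N (u n)) + 2 * \<sigma> n * norm h * a n)"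
    if "2 * \<beta> * \<sigma> n < min 1 (\<kappa> / 2)" for n
  proof -
    have "\<beta> * \<sigma> n \<le> 1"
      using that by simp
    then show ?thesis
      unfolding \<kappa>_def X_def a_def
      using energy_estimate[OF \<open>0 \<le> \<beta>\<close> \<open>\<alpha> > 0\<close> form[OF u(1)] coc u(2), of n] \<tau>(1) \<sigma>_nonneg
      unfolding \<sigma>_def by blast
  qed
  have X_le: "\<forall>\<^sub>F n in sequentially. X n \<le> C * a n"
    using ev_a ev_\<sigma> ev_\<sigma>1
  proof eventually_elim
    case (elim n)
    have "\<kappa> / 2 * X n \<le> (\<kappa> - 2 * \<beta> * \<sigma> n) * X n"
      using elim(2) X_nonneg by (intro mult_right_mono) auto
    also have "\<dots> \<le> inner h (u n) +
        \<beta> * ((norm h)\<^sup>2 + 2 * norm h * norm (N (u n)) + 2 * \<sigma> n * norm h * a n)"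
      by (rule energy[OF elim(2)])
    also have "\<dots> \<le> norm h * a n +
        \<beta> * ((norm h)\<^sup>2 * a n + 2 * norm h * (a n / \<alpha>) + 2 * 1 * norm h * a n)"
    proof (intro add_mono mult_left_mono mult_right_mono \<open>0 \<le> \<beta>\<close> N_le)
      show "inner h (u n) \<le> norm h * a n"
        unfolding a_def by (rule norm_cauchy_schwarz)
      show "(norm h)\<^sup>2 \<le> (norm h)\<^sup>2 * a n"
        using mult_left_mono[OF elim(1), of "(norm h)\<^sup>2"] by simp
    qed (use elim in auto)
    also have "\<dots> = \<kappa> / 2 * (C * a n)"
      using \<open>\<kappa> > 0\<close> \<open>\<alpha> > 0\<close> by (simp add: C_def field_simps)
    finally show ?case
      using \<open>\<kappa> > 0\<close> by simp
  qed
  define q where "q n = norm (N (u n)) / a n" for n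
  have "q \<longlonglongrightarrow> 0"
  proof -
    have "(\<lambda>n. (q n)\<^sup>2) \<longlonglongrightarrow> 0"
    proof (rule tendsto_sandwich[where f = "\<lambda>_. 0"])
      show "(\<lambda>n. C / \<alpha> * (1 / a n)) \<longlonglongrightarrow> 0"
        using tendsto_mult_left[OF inverse_a, of "C / \<alpha>"] by simp
      show "\<forall>\<^sub>F n in sequentially. (q n)\<^sup>2 \<le> C / \<alpha> * (1 / a n)"
        using ev_a X_le
      proof eventually_elim
        case (elim n)
        have "\<alpha> * (norm (N (u n)))\<^sup>2 \<le> C * a n"
          using coc[of "u n"] elim(2) unfolding X_def by linarith
        then show ?case
          using elim(1) \<open>\<alpha> > 0\<close> by (simp add: q_def field_simps power2_eq_square)
      qed
    qed auto
    then have "(\<lambda>n. sqrt ((q n)\<^sup>2)) \<longlonglongrightarrow> sqrt 0"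
      by (rule tendsto_real_sqrt)
    then show ?thesis
      by (simp add: tendsto_rabs_zero_iff)
  qed
  define v where "v n = (1 / a n) *\<^sub>R u n" for n
  define x where "x n = X n / a n" for n
  have "norm (v n) \<le> 1" for n
    by (simp add: v_def a_def)
  then obtain r v0 where r: "strict_mono (r :: nat \<Rightarrow> nat)"
    and weak: "\<And>w. (\<lambda>n. inner (v (r n)) w) \<longlonglongrightarrow> inner v0 w"
    using bounded_seq_weakly_convergent_subseq[OF separable, of v 1] by metis
  have sub: "filterlim r at_top sequentially"
    using r by (rule filterlim_subseq)
  have "(\<lambda>n. L (v n)) \<longlonglongrightarrow> 0"
  proof (rule Lim_null_comparison)
    show "(\<lambda>n. norm h * (1 / a n) + q n + \<sigma> n) \<longlonglongrightarrow> 0"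
      using tendsto_add[OF tendsto_add[OF tendsto_mult_left[OF inverse_a, of "norm h"] \<open>q \<longlonglongrightarrow> 0\<close>] \<sigma>_lim]
      by simp
    show "\<forall>\<^sub>F n in sequentially. norm (L (v n)) \<le> norm h * (1 / a n) + q n + \<sigma> n"
      using ev_a
    proof eventually_elim
      case (elim n)
      have "norm (L (u n)) \<le> (1 + \<tau> n) * norm (L (u n))"
        using \<tau>(1)[of n] by (simp add: distrib_right)
      also have "\<dots> = norm (h - N (u n) - \<sigma> n *\<^sub>R u n)"
      proof -
        have "(1 + \<tau> n) *\<^sub>R L (u n) = h - N (u n) - \<sigma> n *\<^sub>R u n"
          using u(2)[of n] by (simp add: \<sigma>_def algebra_simps)
        then show ?thesis
          using \<tau>(1)[of n] by (metis abs_of_nonneg add_nonneg_nonneg norm_scaleR zero_le_one)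
      qed
      also have "\<dots> \<le> norm h + norm (N (u n)) + \<sigma> n * a n"
        using norm_triangle_ineq4[of "h - N (u n)" "\<sigma> n *\<^sub>R u n"] norm_triangle_ineq4[of h "N (u n)"]
          \<sigma>_nonneg[of n] by (simp add: a_def)
      finally have "norm (L (u n)) / a n \<le> (norm h + norm (N (u n)) + \<sigma> n * a n) / a n"
        using elim by (intro divide_right_mono) auto
      moreover have "norm (L (v n)) = norm (L (u n)) / a n"
        using elim by (simp add: v_def linear_operator_scaleR(2)[OF lin u(1)])
      ultimately show ?case
        using elim by (simp add: q_def add_divide_distrib)
    qed
  qed
  then have "(\<lambda>n. L (v (r n))) \<longlonglongrightarrow> 0"
    using sub by (rule filterlim_compose)
  then have "weakly_tendsto (\<lambda>n. L (v (r n))) 0"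
    unfolding weakly_tendsto_iff_inner using tendsto_inner[OF _ tendsto_const] by blast
  moreover have weak_v: "weakly_tendsto (\<lambda>n. v (r n)) v0"
    using weak by (simp add: weakly_tendsto_iff_inner)
  moreover have "v (r n) \<in> D" for n
    unfolding v_def by (intro linear_operator_scaleR(1)[OF lin] u(1))
  ultimately have v0: "v0 \<in> D" "L v0 = 0"
    using self_adjoint_weakly_closed[OF sa, of "\<lambda>n. v (r n)" v0 0] by auto
  \<comment> \<open>The errors in the second use of the energy estimate, after division by \<open>a n\<close>.\<close>
  define e where "e n = 2 * \<beta> * \<sigma> n * C + \<beta> * ((norm h)\<^sup>2 * (1 / a n) + 2 * norm h * q n + 2 * \<sigma> n * norm h)"
    for n
  have "e \<longlonglongrightarrow> 2 * \<beta> * 0 * C + \<beta> * ((norm h)\<^sup>2 * 0 + 2 * norm h * 0 + 2 * 0 * norm h)"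
    unfolding e_def by (intro tendsto_intros inverse_a \<open>q \<longlonglongrightarrow> 0\<close> \<sigma>_lim)
  then have e_lim: "e \<longlonglongrightarrow> 0" by simp
  define y where "y n = (inner h (v n) + e n) / \<kappa>" for n
  have x_le_y: "\<forall>\<^sub>F n in sequentially. x n \<le> y n"
    using ev_a ev_\<sigma> X_le
  proof eventually_elim
    case (elim n)
    have "2 * \<beta> * \<sigma> n * X n \<le> 2 * \<beta> * \<sigma> n * (C * a n)"
      using elim(3) \<open>0 \<le> \<beta>\<close> \<sigma>_nonneg by (intro mult_left_mono) auto
    then have "\<kappa> * X n \<le> inner h (u n) + 2 * \<beta> * \<sigma> n * (C * a n) +
        \<beta> * ((norm h)\<^sup>2 + 2 * norm h * norm (N (u n)) + 2 * \<sigma> n * norm h * a n)"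
      using energy[OF elim(2)] by (simp add: left_diff_distrib)
    also have "\<dots> = a n * (inner h (v n) + e n)"
      using elim(1) by (simp add: e_def v_def q_def field_simps)
    finally show ?case
      using elim(1) \<open>\<kappa> > 0\<close> by (simp add: x_def y_def field_simps)
  qed
  define m where "m = inner h v0 / \<kappa>"
  have "(\<lambda>n. inner h (v (r n))) \<longlonglongrightarrow> inner h v0"
    using weak[of h] by (simp add: inner_commute)
  then have "(\<lambda>n. y (r n)) \<longlonglongrightarrow> (inner h v0 + 0) / \<kappa>"
    unfolding y_def using \<open>\<kappa> > 0\<close>
    by (intro tendsto_divide tendsto_add tendsto_const filterlim_compose[OF e_lim sub]) auto
  then have y_lim: "(\<lambda>n. y (r n)) \<longlonglongrightarrow> m"
    by (simp add: m_def)
  \<comment> \<open>This is used with \<open>\<rho> = 1\<close> for the growth condition and with \<open>\<rho> = \<parallel>v0\<parallel>\<close> for the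
    recession functional.\<close>
  have limsup_x: "limsup (\<lambda>n. ereal (x (r n) / \<rho>)) \<le> ereal (m / \<rho>)" if "\<rho> > 0" for \<rho>
  proof -
    have "\<forall>\<^sub>F n in sequentially. x (r n) \<le> y (r n)"
      using sub x_le_y unfolding filterlim_iff by blast
    then have "limsup (\<lambda>n. ereal (x (r n) / \<rho>)) \<le> limsup (\<lambda>n. ereal (y (r n) / \<rho>))"
      using that by (intro Limsup_mono) (auto simp: divide_right_mono elim!: eventually_mono)
    also have "\<dots> = ereal (m / \<rho>)"
      using that by (intro lim_imp_Limsup) (auto intro!: tendsto_intros y_lim)
    finally show ?thesis .
  qed
  define c where "c = \<beta> * norm h / (\<alpha> - \<beta>)"
  have "c \<ge> 0"
    using \<open>0 \<le> \<beta>\<close> \<open>\<beta> < \<alpha>\<close> by (simp add: c_def)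
  have "filterlim (\<lambda>n. norm (u (r n))) at_top sequentially"
    using blowup sub by (rule filterlim_compose)
  then have "ereal c < limsup (\<lambda>n. ereal (x (r n) / 1))"
    using growth[of "\<lambda>n. u (r n)"] by (simp add: c_def x_def X_def a_def Re_cinner)
  also have "\<dots> \<le> ereal (m / 1)"
    by (rule limsup_x) simp
  finally have "m > 0"
    using \<open>c \<ge> 0\<close> by simp
  then have "v0 \<noteq> 0"
    by (auto simp: m_def)
  define \<rho> where "\<rho> = norm v0"
  have "\<rho> > 0"
    using \<open>v0 \<noteq> 0\<close> by (simp add: \<rho>_def)
  define e0 where "e0 = (1 / \<rho>) *\<^sub>R v0"
  have "norm e0 = 1" and "e0 \<in> op_kernel D L"
    using \<open>\<rho> > 0\<close> v0 linear_operator_scaleR[OF lin v0(1)] by (auto simp: e0_def \<rho>_def op_kernel_def)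
  then have "ereal (c + inner h e0) < recession N e0"
    using rec by (simp add: c_def Re_cinner)
  \<comment> \<open>Homogeneity: \<open>u (r k)\<close> is written as \<open>\<rho> * a (r k)\<close> times \<open>v (r k) / \<rho>\<close>, and the second
    factor converges weakly to the unit vector \<open>e0\<close>.\<close>
  also have "recession N e0 \<le> liminf (\<lambda>k. ereal (Re (cinner
      (N ((\<rho> * a (r k)) *\<^sub>R ((1 / \<rho>) *\<^sub>R v (r k)))) ((1 / \<rho>) *\<^sub>R v (r k)))))"
    unfolding recession_def
  proof (intro Inf_lower CollectI exI conjI)
    show "filterlim (\<lambda>k. \<rho> * a (r k)) at_top sequentially"
      unfolding a_def using \<open>\<rho> > 0\<close>
      by (intro filterlim_tendsto_pos_mult_at_top[OF tendsto_const] filterlim_compose[OF blowup sub])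
    show "weakly_tendsto (\<lambda>k. (1 / \<rho>) *\<^sub>R v (r k)) e0"
      unfolding weakly_tendsto_iff_inner e0_def inner_scaleR_left
      by (intro allI tendsto_mult_left weak)
  qed simp
  also have "\<dots> = liminf (\<lambda>k. ereal (x (r k) / \<rho>))"
  proof -
    have "(\<rho> * a n) *\<^sub>R ((1 / \<rho>) *\<^sub>R v n) = u n" for n
      using \<open>\<rho> > 0\<close> by (cases "u n = 0") (simp_all add: v_def a_def)
    moreover have "inner (N (u n)) ((1 / \<rho>) *\<^sub>R v n) = x n / \<rho>" for n
      by (simp add: v_def x_def X_def)
    ultimately show ?thesis
      by (simp only: Re_cinner)
  qed
  also have "\<dots> \<le> limsup (\<lambda>k. ereal (x (r k) / \<rho>))"
    by (rule Liminf_le_Limsup) simp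
  also have "\<dots> \<le> ereal (m / \<rho>)"
    by (rule limsup_x) fact
  finally have "c + inner h e0 < m / \<rho>"
    by simp
  moreover have "m / \<rho> \<le> c + inner h e0"
  proof -
    have "m / \<rho> = 1 / \<kappa> * inner h e0"
      by (simp add: m_def e0_def)
    also have "1 / \<kappa> = 1 + \<beta> / (\<alpha> - \<beta>)"
      using \<open>\<beta> < \<alpha>\<close> \<open>\<alpha> > 0\<close> by (simp add: \<kappa>_def field_simps)
    finally have "m / \<rho> = inner h e0 + \<beta> / (\<alpha> - \<beta>) * inner h e0"
      by (simp add: distrib_right)
    moreover have "\<beta> / (\<alpha> - \<beta>) * inner h e0 \<le> \<beta> / (\<alpha> - \<beta>) * norm h"
      using norm_cauchy_schwarz[of h e0] \<open>norm e0 = 1\<close> \<open>0 \<le> \<beta>\<close> \<open>\<beta> < \<alpha>\<close>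
      by (intro mult_left_mono) auto
    ultimately show ?thesis
      by (simp add: c_def)
  qed
  ultimately show False by linarith
qed

section \<open>The fixed point equation\<close>

text \<open>
  Applied to \<open>p = N u - N u'\<close> and \<open>d = u - u'\<close>, this says that
  \<open>s - N\<close> is Lipschitz with constant \<open>s = 1 / (2 * \<alpha>)\<close>: for this
  shift, the cross term in the square of the norm compensates
  \<open>\<parallel>p\<parallel>\<^sup>2\<close>.
\<close>

lemma cocoercive_reflection_nonexpansive:
  fixes p d :: "'a::real_inner"
  assumes "\<alpha> > 0" and "\<alpha> * (norm p)\<^sup>2 \<le> inner p d"
  shows "norm ((1 / (2 * \<alpha>)) *\<^sub>R d - p) \<le> 1 / (2 * \<alpha>) * norm d"
proof (rule power2_le_imp_le)
  have "(norm p)\<^sup>2 \<le> inner p d / \<alpha>"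
    using assms by (simp add: field_simps)
  moreover have "(norm ((1 / (2 * \<alpha>)) *\<^sub>R d - p))\<^sup>2 =
      (1 / (2 * \<alpha>) * norm d)\<^sup>2 - inner p d / \<alpha> + (norm p)\<^sup>2"
    using \<open>\<alpha> > 0\<close> unfolding power_mult_distrib power2_norm_eq_inner
    by (simp add: inner_simps inner_commute field_simps power2_eq_square)
  ultimately show "(norm ((1 / (2 * \<alpha>)) *\<^sub>R d - p))\<^sup>2 \<le> (1 / (2 * \<alpha>) * norm d)\<^sup>2"
    by linarith
qed (use assms in auto)

text \<open>
  For \<open>l = L z\<close> this bounds the norm of \<open>(L + s)\<^sup>-\<^sup>1\<close> by
  \<open>1 / s\<close>.
\<close>

lemma shift_expanding_if_form_bound:
  fixes l z :: "'a::real_inner"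
  assumes "s \<ge> 0" and "2 * s * \<beta> \<le> 1" and "- \<beta> * (norm l)\<^sup>2 \<le> inner l z"
  shows "s * norm z \<le> norm (l + s *\<^sub>R z)"
proof (rule power2_le_imp_le)
  have "2 * s * (- \<beta> * (norm l)\<^sup>2) \<le> 2 * s * inner l z"
    using assms by (intro mult_left_mono) auto
  then have "- (2 * s * \<beta> * (norm l)\<^sup>2) \<le> 2 * s * inner l z"
    by (simp only: mult_minus_left mult_minus_right mult.assoc)
  moreover have "2 * s * \<beta> * (norm l)\<^sup>2 \<le> (norm l)\<^sup>2"
    using mult_right_mono[OF assms(2), of "(norm l)\<^sup>2"] by simp
  moreover have "(norm (l + s *\<^sub>R z))\<^sup>2 = (norm l)\<^sup>2 + 2 * s * inner l z + (s * norm z)\<^sup>2"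
    unfolding power_mult_distrib power2_norm_eq_inner
    by (simp add: inner_simps inner_commute algebra_simps power2_eq_square)
  ultimately show "(s * norm z)\<^sup>2 \<le> (norm (l + s *\<^sub>R z))\<^sup>2"
    by linarith
qed simp

theorem theorem3p4:
  fixes D :: "'a::complex_hilbert set" and L N :: "'a \<Rightarrow> 'a" and h :: 'a
    and \<alpha> \<gamma> \<delta> :: real
  assumes "separable_space (euclidean :: 'a topology)"
    and "self_adjoint D L"
    and "0 \<in> spectrum D L"
    and "\<delta> > 0" and "complex_of_real ` {-\<delta><..<0} \<subseteq> resolvent_set D L"
    and "\<gamma> \<ge> 0" and "(INF z\<in>spectrum D L. ereal (Re z)) = ereal (- \<gamma>)"
    and "bounded_map N" and "demicontinuous N" and "N 0 = 0"
    and "\<alpha> > \<gamma> / \<delta>\<^sup>2"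
    and "\<And>u u'. Re (cinner (N u - N u') (u - u')) \<ge> \<alpha> * (norm (N u - N u'))\<^sup>2"
    and "\<And>u :: nat \<Rightarrow> 'a. filterlim (\<lambda>k. norm (u k)) at_top sequentially \<Longrightarrow>
           limsup (\<lambda>k. ereal (Re (cinner (N (u k)) (u k)) / norm (u k)))
             > ereal (\<gamma> * norm h / (\<delta>\<^sup>2 * \<alpha> - \<gamma>))"
    and "\<And>u. u \<in> op_kernel D L \<Longrightarrow> norm u = 1 \<Longrightarrow>
           recession N u > ereal (\<gamma> * norm h / (\<delta>\<^sup>2 * \<alpha> - \<gamma>) + Re (cinner h u))"
  shows "\<exists>u\<in>D. L u + N u = h"
proof -
  note separable = assms(1) and sa = assms(2) and coc = assms(12)
  define \<beta> where "\<beta> = \<gamma> / \<delta>\<^sup>2"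
  define s where "s = 1 / (2 * \<alpha>)"
  have "\<beta> \<ge> 0" and "\<beta> < \<alpha>"
    using assms(6,11) by (auto simp: \<beta>_def)
  then have "\<alpha> > 0" by linarith
  then have "s > 0"
    by (simp add: s_def)
  have "2 * s * \<beta> \<le> 1"
    using \<open>\<beta> < \<alpha>\<close> \<open>\<alpha> > 0\<close> by (simp add: s_def)
  then have s_small: "2 * s * \<gamma> \<le> \<delta>\<^sup>2"
    using \<open>\<delta> > 0\<close> by (simp add: \<beta>_def field_simps)
  have c_eq: "\<gamma> * norm h / (\<delta>\<^sup>2 * \<alpha> - \<gamma>) = \<beta> * norm h / (\<alpha> - \<beta>)"
  proof -
    have "\<delta>\<^sup>2 * \<alpha> - \<gamma> = \<delta>\<^sup>2 * (\<alpha> - \<beta>)"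
      using \<open>\<delta> > 0\<close> by (simp add: \<beta>_def field_simps)
    then show ?thesis
      using \<open>\<delta> > 0\<close> by (simp add: \<beta>_def)
  qed
  note gap = spectral_gap_consequences[OF sa assms(4,5,6,7)]
  have form: "- \<beta> * (norm (L u))\<^sup>2 \<le> inner (L u) u" if "u \<in> D" for u
    using gap(1)[OF that] by (simp add: \<beta>_def)
  have lin: "linear_operator D L"
    using sa by (simp add: self_adjoint_def)
  obtain A where A_D: "\<And>y. A y \<in> D" and LA: "\<And>y. L (A y) - (- s) *\<^sub>R A y = y"
    using gap(2)[OF \<open>s > 0\<close> s_small] by (rule real_resolventE) blast
  define T where "T u = A (s *\<^sub>R u - N u + h)" for u
  have nonexp: "norm (T u - T u') \<le> norm (u - u')" for u u'
  proof -
    define z where "z = T u - T u'"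
    have "z \<in> D"
      unfolding z_def T_def by (intro linear_operator_diff(1)[OF lin] A_D)
    have "s * norm z \<le> norm (L z + s *\<^sub>R z)"
      using \<open>s > 0\<close> \<open>2 * s * \<beta> \<le> 1\<close> form[OF \<open>z \<in> D\<close>]
      by (intro shift_expanding_if_form_bound) auto
    also have "L z + s *\<^sub>R z = s *\<^sub>R (u - u') - (N u - N u')"
    proof -
      have "L (A y) = y - s *\<^sub>R A y" for y
        using LA[of y] by (simp add: algebra_simps)
      then show ?thesis
        by (simp add: z_def T_def linear_operator_diff(2)[OF lin A_D A_D] algebra_simps)
    qed
    also have "norm (s *\<^sub>R (u - u') - (N u - N u')) \<le> s * norm (u - u')"
      using cocoercive_reflection_nonexpansive[OF \<open>\<alpha> > 0\<close>] coc unfolding s_def Re_cinner by blast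
    finally show ?thesis
      using \<open>s > 0\<close> by (simp add: z_def)
  qed
  show ?thesis
  proof (rule nonexpansive_fixpoint_or_blowup[of T, OF nonexp])
    fix u assume "T u = u"
    then have "u \<in> D" and "L u + s *\<^sub>R u = s *\<^sub>R u - N u + h"
      using A_D[of "s *\<^sub>R u - N u + h"] LA[of "s *\<^sub>R u - N u + h"] by (auto simp: T_def)
    then show ?thesis
      by (intro bexI[of _ u]) (auto simp: algebra_simps)
  next
    fix u :: "nat \<Rightarrow> 'a"
    assume Tu: "\<And>n. T (u n) = (1 + 1 / real (Suc n)) *\<^sub>R u n"
      and blowup: "filterlim (\<lambda>n. norm (u n)) at_top sequentially"
    \<comment> \<open>Applying \<open>L + s\<close> to \<open>T (u n) = (1 + \<tau> n) u n\<close> turns it into the regularized equation.\<close>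
    define \<tau> where "\<tau> n = 1 / real (Suc n)" for n
    have "\<tau> n \<ge> 0" for n
      by (simp add: \<tau>_def)
    then have "1 + \<tau> n \<noteq> 0" for n
      by (metis add_nonneg_eq_0_iff zero_le_one zero_neq_one)
    have u_D: "u n \<in> D" for n
    proof -
      have "(1 / (1 + \<tau> n)) *\<^sub>R T (u n) \<in> D"
        unfolding T_def by (intro linear_operator_scaleR(1)[OF lin] A_D)
      then show ?thesis
        using \<open>1 + \<tau> n \<noteq> 0\<close> unfolding Tu \<tau>_def[symmetric] by simp
    qed
    have "(1 + \<tau> n) *\<^sub>R L (u n) + (s * \<tau> n) *\<^sub>R u n + N (u n) = h" for n
    proof -
      have "L (T (u n)) + s *\<^sub>R T (u n) = s *\<^sub>R u n - N (u n) + h"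
        using LA[of "s *\<^sub>R u n - N (u n) + h"] by (simp add: T_def)
      then show ?thesis
        unfolding Tu \<tau>_def[symmetric] linear_operator_scaleR(2)[OF lin u_D]
        by (simp add: algebra_simps)
    qed
    moreover have "\<tau> \<longlonglongrightarrow> 0"
      using LIMSEQ_inverse_real_of_nat by (simp add: \<tau>_def[abs_def] inverse_eq_divide)
    moreover have "\<alpha> * (norm (N u))\<^sup>2 \<le> inner (N u) u" for u
      using coc[of u 0] \<open>N 0 = 0\<close> by (simp add: Re_cinner)
    ultimately have "\<not> filterlim (\<lambda>n. norm (u n)) at_top sequentially"
      using \<open>\<And>n. \<tau> n \<ge> 0\<close> \<open>s > 0\<close> u_D
      by (intro bounded_along_regularization[where s = s and \<tau> = \<tau> and u = u,
            OF separable sa \<open>\<beta> \<ge> 0\<close> \<open>\<beta> < \<alpha>\<close> _ form _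
            assms(13)[unfolded c_eq] assms(14)[unfolded c_eq]]) auto
    then show ?thesis
      using blowup by contradiction
  qed
qed

end
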